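(* Let $(\mathcal G,G(t))$ be an invariant Ricci flow on a nilpotent Lie group. Then $$\frac{d}{dt}\mathcal W_+(G(t),t)=-t^2\Big|\delta\Big(\mathrm{Rc}_G+\frac{\mathbb 1}{2t}\Big)\Big|^2 .$$
   Context: An invariant metric on a Lie group is a translation-invariant Riemannian metric; tensors are evaluated at the identity, i.e. on the Lie algebra $\mathfrak g$. An invariant Ricci flow is a family of invariant metrics with $\partial_tG=-2\mathrm{Ric}_G$. For an invariant metric $G$ on a nilpotent Lie group with $G$-orthonormal basis $\{e_i\}$ of $\mathfrak g$: $\mathrm{Ric}_G(x,y)=-\frac12\sum_iG([x,e_i],[y,e_i])+\frac14\sum_{i,j}G([e_i,e_j],x)G([e_i,e_j],y)$, $R_G=-\frac14\sum_{i,j}|[e_i,e_j]|^2$, and $\mathrm{Rc}_G\in\mathrm{End}\,\mathfrak g$ is given by $G(\mathrm{Rc}_Gx,y)=\mathrm{Ric}_G(x,y)$. For $A\in\mathrm{End}\,\mathfrak g$, $\delta(A)(x,y)=A[x,y]-[Ax,y]-[x,Ay]$, with norm $|\delta(A)|^2=\sum_{i,j}|\delta(A)(e_i,e_j)|_G^2$. Definition. $\mathcal W_+(G,\tau)=\tau R_G+\tau^2|\mathrm{Ric}_G|^2$ for $\tau\in\mathbb R$. *)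

theory Defs
  imports "HOL-Analysis.Analysis" "HOL-Algebra.Generated_Groups"
begin

section \<open>Lie groups\<close>

text \<open>On an open set of a finite-dimensional space, being of class C^(k+1) means being
  differentiable with all directional derivatives of class C^k. The definition is only meant for
  open sets.\<close>

primrec Ck_on :: "nat \<Rightarrow> ('a::real_normed_vector \<Rightarrow> 'b::real_normed_vector) \<Rightarrow> 'a set \<Rightarrow> bool" where
  "Ck_on 0 f S \<longleftrightarrow> continuous_on S f"
| "Ck_on (Suc k) f S \<longleftrightarrow> f differentiable_on S \<and>
     (\<forall>v. Ck_on k (\<lambda>x. frechet_derivative f (at x) v) S)"

definition smooth_on :: "('a::real_normed_vector \<Rightarrow> 'b::real_normed_vector) \<Rightarrow> 'a set \<Rightarrow> bool" where
  "smooth_on f S \<longleftrightarrow> (\<forall>k. Ck_on k f S)"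

text \<open>A chart is a domain together with a coordinate map that is meaningful on that domain.\<close>

type_synonym ('g, 'a) chart = "'g set \<times> ('g \<Rightarrow> 'a)"

abbreviation chart_dom :: "('g, 'a) chart \<Rightarrow> 'g set" where
  "chart_dom c \<equiv> fst c"

abbreviation chart_map :: "('g, 'a) chart \<Rightarrow> 'g \<Rightarrow> 'a" where
  "chart_map c \<equiv> snd c"

abbreviation chart_inv :: "('g, 'a) chart \<Rightarrow> 'a \<Rightarrow> 'g" where
  "chart_inv c \<equiv> inv_into (fst c) (snd c)"

text \<open>The continuity of the group operations makes the domains of their coordinate expressions
  open.\<close>

locale lie_group = group \<G>
  for \<G> :: "('g, 'm) monoid_scheme" (structure)
    and T :: "'g topology"
    and \<A> :: "('g, 'a::euclidean_space) chart set" +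
  assumes topspace: "topspace T = carrier \<G>"
    and Hausdorff: "Hausdorff_space T"
    and second_countable: "second_countable T"
    and chart_open: "c \<in> \<A> \<Longrightarrow> openin T (chart_dom c) \<and> open (chart_map c ` chart_dom c)"
    and chart_homeomorphic:
      "c \<in> \<A> \<Longrightarrow> homeomorphic_map (subtopology T (chart_dom c))
                    (top_of_set (chart_map c ` chart_dom c)) (chart_map c)"
    and charts_cover: "(\<Union>c\<in>\<A>. chart_dom c) = carrier \<G>"
    and charts_compatible:
      "c \<in> \<A> \<Longrightarrow> d \<in> \<A> \<Longrightarrow>
        smooth_on (\<lambda>x. chart_map d (chart_inv c x)) (chart_map c ` (chart_dom c \<inter> chart_dom d))"
    and mult_continuous: "continuous_map (prod_topology T T) T (\<lambda>(p, q). p \<otimes> q)"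
    and inv_continuous: "continuous_map T T (\<lambda>p. inv p)"
    and mult_smooth:
      "b \<in> \<A> \<Longrightarrow> c \<in> \<A> \<Longrightarrow> d \<in> \<A> \<Longrightarrow>
        smooth_on (\<lambda>(x, y). chart_map d (chart_inv b x \<otimes> chart_inv c y))
          {(chart_map b p, chart_map c q) | p q.
             p \<in> chart_dom b \<and> q \<in> chart_dom c \<and> p \<otimes> q \<in> chart_dom d}"
    and inv_smooth:
      "c \<in> \<A> \<Longrightarrow> d \<in> \<A> \<Longrightarrow>
        smooth_on (\<lambda>x. chart_map d (inv (chart_inv c x)))
          {chart_map c p | p. p \<in> chart_dom c \<and> inv p \<in> chart_dom d}"

primrec lower_central :: "('g, 'm) monoid_scheme \<Rightarrow> nat \<Rightarrow> 'g set" where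
  "lower_central \<G> 0 = carrier \<G>"
| "lower_central \<G> (Suc n) =
     generate \<G> {p \<otimes>\<^bsub>\<G>\<^esub> q \<otimes>\<^bsub>\<G>\<^esub> inv\<^bsub>\<G>\<^esub> p \<otimes>\<^bsub>\<G>\<^esub> inv\<^bsub>\<G>\<^esub> q | p q.
        p \<in> carrier \<G> \<and> q \<in> lower_central \<G> n}"

definition nilpotent_group :: "('g, 'm) monoid_scheme \<Rightarrow> bool" where
  "nilpotent_group \<G> \<longleftrightarrow> (\<exists>n. lower_central \<G> n = {\<one>\<^bsub>\<G>\<^esub>})"

text \<open>For a chart \<open>c\<close> around the identity, the coordinates of \<open>c\<close> identify the tangent space at
  the identity with the model space \<open>'a\<close>. In these coordinates, the left-invariant vector
  field \<open>left_inv_field \<G> c w\<close> has the value \<open>w\<close> at the identity, and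
  \<open>lie_bracket \<G> c v w\<close> is the value at the identity of the commutator
  \<open>[V, W] = DW V - DV W\<close> of the left-invariant fields extending \<open>v\<close> and \<open>w\<close>.\<close>

definition left_inv_field ::
  "('g, 'm) monoid_scheme \<Rightarrow> ('g, 'a::euclidean_space) chart \<Rightarrow> 'a \<Rightarrow> 'a \<Rightarrow> 'a" where
  "left_inv_field \<G> c w x =
     frechet_derivative (\<lambda>y. chart_map c (chart_inv c x \<otimes>\<^bsub>\<G>\<^esub> chart_inv c y))
       (at (chart_map c \<one>\<^bsub>\<G>\<^esub>)) w"

definition lie_bracket ::
  "('g, 'm) monoid_scheme \<Rightarrow> ('g, 'a::euclidean_space) chart \<Rightarrow> 'a \<Rightarrow> 'a \<Rightarrow> 'a" where
  "lie_bracket \<G> c v w =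
     frechet_derivative (left_inv_field \<G> c w) (at (chart_map c \<one>\<^bsub>\<G>\<^esub>)) v
   - frechet_derivative (left_inv_field \<G> c v) (at (chart_map c \<one>\<^bsub>\<G>\<^esub>)) w"

section \<open>Invariant metrics\<close>

definition inner_product :: "('a::real_vector \<Rightarrow> 'a \<Rightarrow> real) \<Rightarrow> bool" where
  "inner_product G \<longleftrightarrow>
     (\<forall>x. linear (G x)) \<and> (\<forall>x y. G x y = G y x) \<and> (\<forall>x. x \<noteq> 0 \<longrightarrow> G x x > 0)"

text \<open>A Riemannian metric is given by its coordinate expressions: \<open>g c p u v\<close> is the inner product
  at the point \<open>p\<close> of the tangent vectors whose coordinates in the chart \<open>c\<close> are \<open>u\<close>
  and \<open>v\<close>.\<close>

type_synonym ('g, 'a) metric = "('g, 'a) chart \<Rightarrow> 'g \<Rightarrow> 'a \<Rightarrow> 'a \<Rightarrow> real"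

definition riemannian_metric ::
  "('g, 'a::euclidean_space) chart set \<Rightarrow> ('g, 'a) metric \<Rightarrow> bool" where
  "riemannian_metric \<A> g \<longleftrightarrow>
     (\<forall>c\<in>\<A>. \<forall>p\<in>chart_dom c. inner_product (g c p)) \<and>
     (\<forall>c\<in>\<A>. \<forall>u v. smooth_on (\<lambda>x. g c (chart_inv c x) u v) (chart_map c ` chart_dom c)) \<and>
     (\<forall>c\<in>\<A>. \<forall>d\<in>\<A>. \<forall>p\<in>chart_dom c \<inter> chart_dom d. \<forall>u v.
        let D = frechet_derivative (\<lambda>x. chart_map d (chart_inv c x)) (at (chart_map c p))
        in g d p (D u) (D v) = g c p u v)"

definition invariant_metric ::
  "('g, 'm) monoid_scheme \<Rightarrow> ('g, 'a::euclidean_space) chart set \<Rightarrow> ('g, 'a) metric \<Rightarrow> bool" where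
  "invariant_metric \<G> \<A> g \<longleftrightarrow> riemannian_metric \<A> g \<and>
     (\<forall>a\<in>carrier \<G>. \<forall>c\<in>\<A>. \<forall>d\<in>\<A>. \<forall>p\<in>chart_dom c. a \<otimes>\<^bsub>\<G>\<^esub> p \<in> chart_dom d \<longrightarrow>
        (\<forall>u v. let D = frechet_derivative (\<lambda>x. chart_map d (a \<otimes>\<^bsub>\<G>\<^esub> chart_inv c x)) (at (chart_map c p))
               in g d (a \<otimes>\<^bsub>\<G>\<^esub> p) (D u) (D v) = g c p u v))"

section \<open>Curvature on the Lie algebra\<close>

text \<open>Below, \<open>br\<close> is a Lie bracket and \<open>G\<close> an inner product. None of the quantities depends
  on the orthonormal basis that is selected.\<close>

definition orthonormal_basis :: "('a::real_vector \<Rightarrow> 'a \<Rightarrow> real) \<Rightarrow> 'a set \<Rightarrow> bool" where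
  "orthonormal_basis G E \<longleftrightarrow> finite E \<and> span E = UNIV \<and>
     (\<forall>x\<in>E. \<forall>y\<in>E. G x y = (if x = y then 1 else 0))"

definition onb :: "('a::real_vector \<Rightarrow> 'a \<Rightarrow> real) \<Rightarrow> 'a set" where
  "onb G = (SOME E. orthonormal_basis G E)"

definition Ric ::
  "('a::euclidean_space \<Rightarrow> 'a \<Rightarrow> 'a) \<Rightarrow> ('a \<Rightarrow> 'a \<Rightarrow> real) \<Rightarrow> 'a \<Rightarrow> 'a \<Rightarrow> real" where
  "Ric br G x y =
     - (1/2) * (\<Sum>e\<in>onb G. G (br x e) (br y e))
     + (1/4) * (\<Sum>e\<in>onb G. \<Sum>f\<in>onb G. G (br e f) x * G (br e f) y)"

definition scal :: "('a::euclidean_space \<Rightarrow> 'a \<Rightarrow> 'a) \<Rightarrow> ('a \<Rightarrow> 'a \<Rightarrow> real) \<Rightarrow> real" where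
  "scal br G = - (1/4) * (\<Sum>e\<in>onb G. \<Sum>f\<in>onb G. G (br e f) (br e f))"

definition Rc :: "('a::euclidean_space \<Rightarrow> 'a \<Rightarrow> 'a) \<Rightarrow> ('a \<Rightarrow> 'a \<Rightarrow> real) \<Rightarrow> 'a \<Rightarrow> 'a" where
  "Rc br G = (THE A. linear A \<and> (\<forall>x y. G (A x) y = Ric br G x y))"

definition Ric_norm2 :: "('a::euclidean_space \<Rightarrow> 'a \<Rightarrow> 'a) \<Rightarrow> ('a \<Rightarrow> 'a \<Rightarrow> real) \<Rightarrow> real" where
  "Ric_norm2 br G = (\<Sum>e\<in>onb G. \<Sum>f\<in>onb G. (Ric br G e f)\<^sup>2)"

definition delta ::
  "('a::euclidean_space \<Rightarrow> 'a \<Rightarrow> 'a) \<Rightarrow> ('a \<Rightarrow> 'a) \<Rightarrow> 'a \<Rightarrow> 'a \<Rightarrow> 'a" where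
  "delta br A x y = A (br x y) - br (A x) y - br x (A y)"

definition delta_norm2 ::
  "('a::euclidean_space \<Rightarrow> 'a \<Rightarrow> 'a) \<Rightarrow> ('a \<Rightarrow> 'a \<Rightarrow> real) \<Rightarrow> ('a \<Rightarrow> 'a) \<Rightarrow> real" where
  "delta_norm2 br G A =
     (\<Sum>e\<in>onb G. \<Sum>f\<in>onb G. G (delta br A e f) (delta br A e f))"

definition W_plus ::
  "('a::euclidean_space \<Rightarrow> 'a \<Rightarrow> 'a) \<Rightarrow> ('a \<Rightarrow> 'a \<Rightarrow> real) \<Rightarrow> real \<Rightarrow> real" where
  "W_plus br G \<tau> = \<tau> * scal br G + \<tau>\<^sup>2 * Ric_norm2 br G"

section \<open>Invariant Ricci flow\<close>

text \<open>The time interval is arbitrary; derivatives at its endpoints, if it has any, are one-sided.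
  Since both sides of the flow equation are invariant tensors, the equation is imposed at the
  identity.\<close>

definition invariant_ricci_flow ::
  "('g, 'm) monoid_scheme \<Rightarrow> ('g, 'a::euclidean_space) chart set \<Rightarrow> real set \<Rightarrow>
   (real \<Rightarrow> ('g, 'a) metric) \<Rightarrow> bool" where
  "invariant_ricci_flow \<G> \<A> I g \<longleftrightarrow> is_interval I \<and>
     (\<forall>t\<in>I. invariant_metric \<G> \<A> (g t)) \<and>
     (\<forall>c\<in>\<A>. \<one>\<^bsub>\<G>\<^esub> \<in> chart_dom c \<longrightarrow>
        (\<forall>t\<in>I. \<forall>x y. ((\<lambda>s. g s c \<one>\<^bsub>\<G>\<^esub> x y) has_real_derivative
            - 2 * Ric (lie_bracket \<G> c) (g t c \<one>\<^bsub>\<G>\<^esub>) x y) (at t within I)))"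

end

theory Submission
  imports Defs
begin

text \<open>Regard the bracket as a fixed bilinear form with values in the Lie algebra and let
  \<open>\<langle>B, C\<rangle>\<close> be the inner product of such forms induced by the metric (\<open>form_inner\<close>). Two facts carry
  the proof. Algebraically, for every endomorphism \<open>A\<close>,
  \<open>\<langle>\<delta>(A), br\<rangle> = 4 tr (Rc A)\<close> (\<open>form_inner_delta_bracket\<close>): the Ricci endomorphism is, up to a
  factor, the image of the bracket under the adjoint of \<open>\<delta>\<close>. Analytically, when the metric changes at
  the rate \<open>G(A x, y)\<close> with \<open>A\<close> self-adjoint, \<open>\<langle>B, C\<rangle>\<close> changes at the rate \<open>\<langle>B, \<delta>(A)\<rangle>\<close>, where
  \<open>\<delta>\<close> is formed with the form \<open>C\<close> in place of the bracket (\<open>form_inner_has_derivative\<close>).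

  Along the Ricci flow \<open>A = -2 Rc\<close>. Since \<open>R = -\<langle>br, br\<rangle> / 4\<close>, the two facts with \<open>B = C = br\<close>
  give \<open>R' = 2 |Ric|\<^sup>2\<close>. With \<open>B = \<delta>(A)\<close> for a fixed \<open>A\<close> they give
  \<open>(tr (Rc A))' = - \<langle>\<delta>(A), \<delta>(Rc)\<rangle> / 2\<close>. As \<open>|Ric|\<^sup>2 = tr (Rc Rc)\<close>, its derivative at a time \<open>t\<close> is
  twice that of \<open>tr (Rc A)\<close> with \<open>A\<close> frozen at \<open>Rc\<close> of time \<open>t\<close>, whence
  \<open>(|Ric|\<^sup>2)' = - |\<delta>(Rc)|\<^sup>2\<close>. Finally \<open>\<delta>(1) = - br\<close>, so expanding the square in
  \<open>- t\<^sup>2 |\<delta>(Rc + 1 / (2 t))|\<^sup>2\<close> yields \<open>R + 4 t |Ric|\<^sup>2 - t\<^sup>2 |\<delta>(Rc)|\<^sup>2\<close>, which is the derivative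
  of \<open>t R + t\<^sup>2 |Ric|\<^sup>2\<close>.

  Two technical points need work. The curvature quantities at different times are defined by unrelated
  orthonormal bases, so differentiating them requires formulas in one fixed basis, in which the
  inverse Gram matrix of the metric appears (\<open>frame_sum_inverse_gram\<close>,
  \<open>has_real_derivative_inverse_matrix\<close>). And the bracket of a Lie group, defined by derivatives
  in a chart, has to be shown to be bilinear (\<open>lie_group.bilinear_lie_bracket\<close>).\<close>

section \<open>Orthonormal frames of an inner product\<close>

lemma inner_product_linear:
  assumes "inner_product G"
  shows "linear (G x)" "linear (\<lambda>x. G x y)"
proof -
  show "linear (G x)" using assms by (simp add: inner_product_def)
  have "(\<lambda>x. G x y) = G y" using assms unfolding inner_product_def by blast
  then show "linear (\<lambda>x. G x y)" using assms by (simp add: inner_product_def)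
qed

lemma inner_product_bilinear: "inner_product G \<Longrightarrow> bilinear G"
  by (simp add: bilinear_def inner_product_linear)

lemma inner_product_commute: "inner_product G \<Longrightarrow> G x y = G y x"
  by (simp add: inner_product_def)

lemma inner_product_eqI:
  assumes G: "inner_product G" and eq: "\<And>y. G x y = G z y"
  shows "x = z"
proof (rule ccontr)
  assume "x \<noteq> z"
  then have "G (x - z) (x - z) > 0" using G by (simp add: inner_product_def)
  moreover have "G (x - z) (x - z) = 0"
    using linear_diff[OF inner_product_linear(2)[OF G], of x z] eq by simp
  ultimately show False by simp
qed

lemma frame_expansion:
  assumes G: "inner_product G" and K: "orthonormal_basis G K"
  shows "(\<Sum>k\<in>K. G x k *\<^sub>R k) = x"
proof -
  have fin: "finite K" using K by (simp add: orthonormal_basis_def)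
  have "x \<in> span K" using K by (simp add: orthonormal_basis_def)
  then obtain u where u: "(\<Sum>k\<in>K. u k *\<^sub>R k) = x"
    using fin by (auto simp: span_finite)
  have "G x k = u k" if "k \<in> K" for k
  proof -
    have "G x k = (\<Sum>j\<in>K. u j * G j k)"
      by (subst u[symmetric])
        (simp add: linear_sum[OF inner_product_linear(2)[OF G]]
          linear_cmul[OF inner_product_linear(2)[OF G]])
    also have "\<dots> = (\<Sum>j\<in>K. if j = k then u j else 0)"
      using K that by (intro sum.cong) (auto simp: orthonormal_basis_def)
    also have "\<dots> = u k" using fin that by simp
    finally show ?thesis .
  qed
  then show ?thesis using u by simp
qed

lemma linear_frame_expansion:
  assumes "inner_product G" "orthonormal_basis G K" "linear L"
  shows "(\<Sum>k\<in>K. G x k *\<^sub>R L k) = L x"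
proof -
  have "L x = L (\<Sum>k\<in>K. G x k *\<^sub>R k)" by (simp only: frame_expansion[OF assms(1,2)])
  also have "\<dots> = (\<Sum>k\<in>K. G x k *\<^sub>R L k)"
    using assms(3) by (simp add: linear_sum linear_cmul)
  finally show ?thesis by simp
qed

lemma linear_frame_expansion_real:
  fixes L :: "'a::real_vector \<Rightarrow> real"
  assumes "inner_product G" "orthonormal_basis G K" "linear L"
  shows "(\<Sum>k\<in>K. G x k * L k) = L x"
  using linear_frame_expansion[OF assms] by simp

lemma orthonormal_imp_independent:
  assumes G: "inner_product G" and fin: "finite K"
    and on: "\<forall>x\<in>K. \<forall>y\<in>K. G x y = (if x = y then 1 else 0)"
  shows "independent K"
proof (rule independent_if_scalars_zero[OF fin])
  fix u x assume 0: "(\<Sum>k\<in>K. u k *\<^sub>R k) = 0" and x: "x \<in> K"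
  have "0 = G (\<Sum>k\<in>K. u k *\<^sub>R k) x"
    using 0 linear_0[OF inner_product_linear(2)[OF G]] by simp
  also have "\<dots> = (\<Sum>j\<in>K. u j * G j x)"
    by (simp add: linear_sum[OF inner_product_linear(2)[OF G]]
          linear_cmul[OF inner_product_linear(2)[OF G]])
  also have "\<dots> = (\<Sum>j\<in>K. if j = x then u j else 0)"
    using on x by (intro sum.cong) auto
  also have "\<dots> = u x" using fin x by simp
  finally show "u x = 0" by simp
qed

text \<open>An orthonormal set is independent, so its size is at most the dimension; one of maximal size
  spans, because the normalized component of a further vector orthogonal to it could be added.\<close>

lemma orthonormal_basis_onb:
  fixes G :: "'a::euclidean_space \<Rightarrow> 'a \<Rightarrow> real"
  assumes G: "inner_product G"
  shows "orthonormal_basis G (onb G)"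
proof -
  define P where "P = (\<lambda>K. finite K \<and> (\<forall>x\<in>K. \<forall>y\<in>K. G x y = (if x = y then 1 else 0)))"
  have bound: "\<forall>K. P K \<longrightarrow> card K < Suc DIM('a)"
  proof (intro allI impI)
    fix K assume "P K"
    then have "independent K" unfolding P_def by (intro orthonormal_imp_independent[OF G]) simp_all
    then show "card K < Suc DIM('a)" using independent_bound[of K] by simp
  qed
  have "P {}" by (simp add: P_def)
  then obtain K where K: "P K" and max: "\<And>K'. P K' \<Longrightarrow> card K' \<le> card K"
    using ex_has_greatest_nat[OF _ bound] by metis
  have fin: "finite K" and on: "\<And>x y. x \<in> K \<Longrightarrow> y \<in> K \<Longrightarrow> G x y = (if x = y then 1 else 0)"
    using K by (auto simp: P_def)
  note lin = inner_product_linear[OF G]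
  have "span K = UNIV"
  proof (rule ccontr)
    assume "span K \<noteq> UNIV"
    then obtain x where x: "x \<notin> span K" by auto
    define z where "z = x - (\<Sum>k\<in>K. G x k *\<^sub>R k)"
    have "z \<noteq> 0"
    proof
      assume "z = 0"
      then have x_eq: "x = (\<Sum>k\<in>K. G x k *\<^sub>R k)" by (simp add: z_def)
      have "x \<in> span K" by (subst x_eq) (intro span_sum span_scale span_base)
      then show False using x by simp
    qed
    then have pos: "G z z > 0" using G by (simp add: inner_product_def)
    have orth: "G z k = 0" if "k \<in> K" for k
    proof -
      have "G (\<Sum>j\<in>K. G x j *\<^sub>R j) k = (\<Sum>j\<in>K. G x j * G j k)"
        by (simp add: linear_sum[OF lin(2)] linear_cmul[OF lin(2)])
      also have "\<dots> = (\<Sum>j\<in>K. if j = k then G x j else 0)"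
        using on that by (intro sum.cong) auto
      also have "\<dots> = G x k" using fin that by simp
      finally show ?thesis by (simp add: z_def linear_diff[OF lin(2)])
    qed
    define w where "w = (1 / sqrt (G z z)) *\<^sub>R z"
    have w1: "G w w = 1"
      using pos by (simp add: w_def linear_cmul[OF lin(2)] linear_cmul[OF lin(1)]
          power2_eq_square[symmetric])
    have w0: "G w k = 0" "G k w = 0" if "k \<in> K" for k
      using orth[OF that] inner_product_commute[OF G, of k w]
      by (simp_all add: w_def linear_cmul[OF lin(2)])
    have "w \<notin> K" using w0(1)[of w] w1 by auto
    moreover have "P (insert w K)" using K w0 w1 by (auto simp: P_def)
    ultimately show False using max[of "insert w K"] fin by simp
  qed
  then have "orthonormal_basis G K" using K by (simp add: P_def orthonormal_basis_def)
  then show ?thesis unfolding onb_def by (rule someI)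
qed

lemma orthonormal_basis_Basis: "orthonormal_basis (\<bullet>) (Basis :: 'a::euclidean_space set)"
  by (simp add: orthonormal_basis_def inner_Basis)

lemma inner_product_inner: "inner_product ((\<bullet>) :: 'a::euclidean_space \<Rightarrow> 'a \<Rightarrow> real)"
  by (auto simp: inner_product_def inner_commute bounded_linear.linear[OF bounded_linear_inner_right])

text \<open>Both sides are the trace of \<open>L\<close>. With \<open>H\<close> the inner product of the model space this
  gives traces that do not mention the metric, so that \<open>tr (Rc A)\<close> can be compared at different times.\<close>

lemma trace_frame_independent:
  assumes G: "inner_product G" "orthonormal_basis G K"
    and H: "inner_product H" "orthonormal_basis H E" and L: "linear L"
  shows "(\<Sum>k\<in>K. G (L k) k) = (\<Sum>e\<in>E. H (L e) e)"
proof -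
  have "(\<Sum>k\<in>K. G (L k) k) = (\<Sum>k\<in>K. \<Sum>e\<in>E. H k e * G (L e) k)"
  proof (rule sum.cong[OF refl])
    fix k
    have "linear (\<lambda>x. G (L x) k)"
      using linear_compose[OF L inner_product_linear(2)[OF G(1)]] by (simp add: o_def)
    from linear_frame_expansion_real[OF H this]
    show "G (L k) k = (\<Sum>e\<in>E. H k e * G (L e) k)" by simp
  qed
  also have "\<dots> = (\<Sum>e\<in>E. \<Sum>k\<in>K. G (L e) k * H k e)"
    by (subst sum.swap) (simp add: mult.commute)
  also have "\<dots> = (\<Sum>e\<in>E. H (L e) e)"
    by (intro sum.cong refl linear_frame_expansion_real[OF G] inner_product_linear(2)[OF H(1)])
  finally show ?thesis .
qed

text \<open>If \<open>E\<close> is an orthonormal basis for \<open>H\<close>, then \<open>inverse_gram H G\<close> restricted to \<open>E\<close> is the inverse of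
  the Gram matrix \<open>G e f\<close>. Defining it through an orthonormal basis of \<open>G\<close> makes it what
  is obtained when a sum over that basis is expanded in \<open>E\<close>.\<close>

definition inverse_gram :: "('a::euclidean_space \<Rightarrow> 'a \<Rightarrow> real) \<Rightarrow> ('a \<Rightarrow> 'a \<Rightarrow> real) \<Rightarrow> 'a \<Rightarrow> 'a \<Rightarrow> real"
  where "inverse_gram H G e f = (\<Sum>k\<in>onb G. H k e * H k f)"

lemma gram_inverse_gram:
  fixes G H :: "'a::euclidean_space \<Rightarrow> 'a \<Rightarrow> real"
  assumes G: "inner_product G" and H: "inner_product H" "orthonormal_basis H E"
  shows "(\<Sum>d\<in>E. G e d * inverse_gram H G d f) = H e f"
proof -
  have "(\<Sum>d\<in>E. G e d * inverse_gram H G d f) = (\<Sum>d\<in>E. \<Sum>k\<in>onb G. H k d * G e d * H k f)"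
    by (simp add: inverse_gram_def sum_distrib_left mult_ac)
  also have "\<dots> = (\<Sum>k\<in>onb G. (\<Sum>d\<in>E. H k d * G e d) * H k f)"
    by (subst sum.swap) (simp add: sum_distrib_right)
  also have "\<dots> = (\<Sum>k\<in>onb G. G e k * H k f)"
    using linear_frame_expansion_real[OF H inner_product_linear(1)[OF G]] by simp
  also have "\<dots> = H e f"
    by (intro linear_frame_expansion_real[OF G orthonormal_basis_onb[OF G]]
        inner_product_linear(2)[OF H(1)])
  finally show ?thesis .
qed

text \<open>This rewrites a contraction over a basis that depends on \<open>G\<close> in an uncontrolled way as
  a sum over the fixed basis \<open>E\<close>, in which only the coefficients depend on \<open>G\<close>.\<close>

lemma frame_sum_inverse_gram:
  fixes \<Phi> :: "'a::euclidean_space \<Rightarrow> 'a \<Rightarrow> real"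
  assumes \<Phi>: "bilinear \<Phi>" and H: "inner_product H" "orthonormal_basis H E"
  shows "(\<Sum>k\<in>onb G. \<Phi> k k) = (\<Sum>e\<in>E. \<Sum>e'\<in>E. inverse_gram H G e e' * \<Phi> e e')"
proof -
  have "\<Phi> k k = (\<Sum>e\<in>E. \<Sum>e'\<in>E. H k e * H k e' * \<Phi> e e')" for k
  proof -
    have "\<Phi> k k = (\<Sum>e\<in>E. H k e * \<Phi> e k)"
      using linear_frame_expansion_real[OF H, of "\<lambda>x. \<Phi> x k" k] \<Phi> by (simp add: bilinear_def)
    also have "\<dots> = (\<Sum>e\<in>E. H k e * (\<Sum>e'\<in>E. H k e' * \<Phi> e e'))"
      using linear_frame_expansion_real[OF H] \<Phi> by (simp add: bilinear_def)
    finally show ?thesis by (simp add: sum_distrib_left mult.assoc)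
  qed
  then have "(\<Sum>k\<in>onb G. \<Phi> k k) = (\<Sum>k\<in>onb G. \<Sum>e\<in>E. \<Sum>e'\<in>E. H k e * H k e' * \<Phi> e e')"
    by simp
  also have "\<dots> = (\<Sum>e\<in>E. \<Sum>k\<in>onb G. \<Sum>e'\<in>E. H k e * H k e' * \<Phi> e e')"
    by (rule sum.swap)
  also have "\<dots> = (\<Sum>e\<in>E. \<Sum>e'\<in>E. \<Sum>k\<in>onb G. H k e * H k e' * \<Phi> e e')"
    by (intro sum.cong refl sum.swap)
  finally show ?thesis by (simp add: inverse_gram_def sum_distrib_right)
qed

text \<open>The rule for differentiating an inverse matrix, at a point where the matrix is the identity. From
  \<open>Q - 1 = - (M - 1) Q\<close> the difference quotient of \<open>Q\<close> is minus that of \<open>M\<close> times \<open>Q\<close>, so all that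
  has to be proved is the continuity of \<open>Q\<close> at \<open>t\<close>, and that follows from the same identity.\<close>

lemma has_real_derivative_inverse_matrix:
  fixes M Q :: "real \<Rightarrow> 'e \<Rightarrow> 'e \<Rightarrow> real"
  assumes fin: "finite E" and t: "t \<in> I"
    and M: "\<And>e f. e \<in> E \<Longrightarrow> f \<in> E \<Longrightarrow>
              ((\<lambda>s. M s e f) has_real_derivative h e f) (at t within I)"
    and Mt: "\<And>e f. e \<in> E \<Longrightarrow> f \<in> E \<Longrightarrow> M t e f = (if e = f then 1 else 0)"
    and MQ: "\<And>s e f. s \<in> I \<Longrightarrow> e \<in> E \<Longrightarrow> f \<in> E \<Longrightarrow>
               (\<Sum>d\<in>E. M s e d * Q s d f) = (if e = f then 1 else 0)"
    and e: "e \<in> E" and f: "f \<in> E"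
  shows "((\<lambda>s. Q s e f) has_real_derivative - h e f) (at t within I)"
proof -
  \<comment> \<open>Entrywise sum norms of \<open>M - 1\<close> and \<open>Q\<close>.\<close>
  define \<epsilon> where "\<epsilon> s = (\<Sum>e\<in>E. \<Sum>d\<in>E. \<bar>M s e d - M t e d\<bar>)" for s
  define q where "q s = (\<Sum>d\<in>E. \<Sum>f\<in>E. \<bar>Q s d f\<bar>)" for s
  have pick: "(\<Sum>d\<in>E. M t e d * r d) = r e" if "e \<in> E" for e and r :: "'e \<Rightarrow> real"
  proof -
    have "(\<Sum>d\<in>E. M t e d * r d) = (\<Sum>d\<in>E. if e = d then r d else 0)"
      using that by (intro sum.cong) (auto simp: Mt)
    then show ?thesis using fin that by simp
  qed
  have Qt: "Q t e f = (if e = f then 1 else 0)" if "e \<in> E" "f \<in> E" for e f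
    using MQ[OF t that] pick[OF that(1)] by simp
  have diff: "Q s e f - Q t e f = - (\<Sum>d\<in>E. (M s e d - M t e d) * Q s d f)"
    if "s \<in> I" "e \<in> E" "f \<in> E" for s e f
    using MQ[OF that] pick[OF that(2), of "\<lambda>d. Q s d f"] Qt[OF that(2,3)]
    by (simp add: left_diff_distrib sum_subtractf)
  have step: "(\<Sum>e\<in>E. \<Sum>f\<in>E. \<bar>Q s e f - Q t e f\<bar>) \<le> \<epsilon> s * q s" if s: "s \<in> I" for s
  proof -
    have "(\<Sum>e\<in>E. \<Sum>f\<in>E. \<bar>Q s e f - Q t e f\<bar>)
        \<le> (\<Sum>e\<in>E. \<Sum>f\<in>E. \<Sum>d\<in>E. \<bar>M s e d - M t e d\<bar> * \<bar>Q s d f\<bar>)"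
      by (intro sum_mono) (simp add: diff[OF s] abs_mult[symmetric] sum_abs)
    also have "\<dots> = (\<Sum>e\<in>E. \<Sum>d\<in>E. \<bar>M s e d - M t e d\<bar> * (\<Sum>f\<in>E. \<bar>Q s d f\<bar>))"
      unfolding sum_distrib_left by (intro sum.cong refl sum.swap)
    also have "\<dots> \<le> (\<Sum>e\<in>E. \<Sum>d\<in>E. \<bar>M s e d - M t e d\<bar> * q s)"
    proof (intro sum_mono mult_left_mono abs_ge_zero)
      fix d assume "d \<in> E"
      then show "(\<Sum>f\<in>E. \<bar>Q s d f\<bar>) \<le> q s"
        unfolding q_def using fin by (intro member_le_sum) (auto intro: sum_nonneg)
    qed
    finally show ?thesis by (simp add: \<epsilon>_def sum_distrib_right)
  qed
  have M0: "((\<lambda>s. M s e d - M t e d) \<longlongrightarrow> 0) (at t within I)" if "e \<in> E" "d \<in> E" for e d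
    using DERIV_continuous[OF M[OF that]] by (auto simp: continuous_within intro: LIM_zero)
  have \<epsilon>0: "(\<epsilon> \<longlongrightarrow> 0) (at t within I)"
    unfolding \<epsilon>_def by (intro tendsto_null_sum tendsto_rabs_zero M0)
  have inI: "eventually (\<lambda>s. s \<in> I) (at t within I)" by (simp add: eventually_at_filter)
  \<comment> \<open>The bound on \<open>Q - Q t\<close> by \<open>\<epsilon> * q\<close> controls \<open>q\<close> itself once \<open>\<epsilon>\<close> is small.\<close>
  have qbound: "eventually (\<lambda>s. q s \<le> 2 * q t) (at t within I)"
    using order_tendstoD(2)[OF \<epsilon>0 half_gt_zero[OF zero_less_one]] inI
  proof eventually_elim
    case (elim s)
    have "q s \<le> (\<Sum>e\<in>E. \<Sum>f\<in>E. \<bar>Q s e f - Q t e f\<bar> + \<bar>Q t e f\<bar>)"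
      unfolding q_def by (intro sum_mono) linarith
    also have "\<dots> = (\<Sum>e\<in>E. \<Sum>f\<in>E. \<bar>Q s e f - Q t e f\<bar>) + q t"
      by (simp add: sum.distrib q_def)
    also have "\<dots> \<le> \<epsilon> s * q s + q t" using step elim by simp
    also have "\<dots> \<le> 1/2 * q s + q t"
      using elim by (intro add_right_mono mult_right_mono) (auto simp: q_def intro!: sum_nonneg)
    finally show ?case by simp
  qed
  have Qlim: "((\<lambda>s. Q s d f) \<longlongrightarrow> Q t d f) (at t within I)" if d: "d \<in> E" for d
  proof -
    have "((\<lambda>s. Q s d f - Q t d f) \<longlongrightarrow> 0) (at t within I)"
    proof (rule Lim_null_comparison)
      show "eventually (\<lambda>s. norm (Q s d f - Q t d f) \<le> \<epsilon> s * (2 * q t)) (at t within I)"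
        using qbound inI
      proof eventually_elim
        case (elim s)
        have "\<bar>Q s d f - Q t d f\<bar> \<le> (\<Sum>f\<in>E. \<bar>Q s d f - Q t d f\<bar>)"
          using fin f by (intro member_le_sum) auto
        also have "\<dots> \<le> (\<Sum>e\<in>E. \<Sum>f\<in>E. \<bar>Q s e f - Q t e f\<bar>)"
          using fin d by (intro member_le_sum[of d E "\<lambda>e. \<Sum>f\<in>E. \<bar>Q s e f - Q t e f\<bar>"])
            (auto intro: sum_nonneg)
        also have "\<dots> \<le> \<epsilon> s * q s" using step elim by simp
        also have "\<dots> \<le> \<epsilon> s * (2 * q t)"
          using elim by (intro mult_left_mono) (auto simp: \<epsilon>_def intro!: sum_nonneg)
        finally show ?case by simp
      qed
      show "((\<lambda>s. \<epsilon> s * (2 * q t)) \<longlongrightarrow> 0) (at t within I)"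
        using tendsto_mult_left_zero[OF \<epsilon>0] .
    qed
    then show ?thesis by (rule LIM_zero_cancel)
  qed
  have "((\<lambda>s. - (\<Sum>d\<in>E. (M s e d - M t e d) / (s - t) * Q s d f)) \<longlongrightarrow>
          - (\<Sum>d\<in>E. h e d * Q t d f)) (at t within I)"
    using M[OF e] Qlim
    by (intro tendsto_minus tendsto_sum tendsto_mult) (auto simp: has_field_derivative_iff)
  moreover have "(\<Sum>d\<in>E. h e d * Q t d f) = (\<Sum>d\<in>E. if d = f then h e d else 0)"
    using f by (intro sum.cong) (auto simp: Qt)
  ultimately have "((\<lambda>s. - (\<Sum>d\<in>E. (M s e d - M t e d) / (s - t) * Q s d f)) \<longlongrightarrow> - h e f)
      (at t within I)"
    using fin f by simp
  moreover have "eventually (\<lambda>s. - (\<Sum>d\<in>E. (M s e d - M t e d) / (s - t) * Q s d f)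
      = (Q s e f - Q t e f) / (s - t)) (at t within I)"
    using inI by eventually_elim (simp add: diff e f sum_divide_distrib)
  ultimately show ?thesis
    unfolding has_field_derivative_iff by (rule Lim_transform_eventually)
qed

section \<open>Ricci curvature of a bilinear bracket\<close>

lemma linear_real_combination:
  fixes \<phi> :: "'i \<Rightarrow> 'a::real_vector \<Rightarrow> real"
  assumes "\<And>i. i \<in> S \<Longrightarrow> linear (\<phi> i)"
  shows "linear (\<lambda>x. \<Sum>i\<in>S. c i * \<phi> i x)"
proof (rule linearI)
  show "(\<Sum>i\<in>S. c i * \<phi> i (x + y)) = (\<Sum>i\<in>S. c i * \<phi> i x) + (\<Sum>i\<in>S. c i * \<phi> i y)" for x y
    using assms by (simp add: sum.distrib[symmetric] linear_add distrib_left)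
  show "(\<Sum>i\<in>S. c i * \<phi> i (r *\<^sub>R x)) = r *\<^sub>R (\<Sum>i\<in>S. c i * \<phi> i x)" for r x
    using assms by (simp add: linear_cmul sum_distrib_left mult.left_commute)
qed

lemma bilinear_real_combination:
  fixes \<Phi> :: "'i \<Rightarrow> 'a::real_vector \<Rightarrow> 'b::real_vector \<Rightarrow> real"
  assumes "\<And>i. i \<in> S \<Longrightarrow> bilinear (\<Phi> i)"
  shows "bilinear (\<lambda>x y. \<Sum>i\<in>S. c i * \<Phi> i x y)"
  using assms unfolding bilinear_def by (intro conjI allI linear_real_combination) simp_all

lemma bilinear_compose:
  assumes "bilinear \<Phi>" "linear f" "linear g"
  shows "bilinear (\<lambda>x y. \<Phi> (f x) (g y))"
  using linear_compose[OF assms(3), of "\<Phi> (f x)" for x] linear_compose[OF assms(2), of "\<lambda>x. \<Phi> x (g y)" for y]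
    assms(1) by (simp add: bilinear_def o_def)

lemma Ric_commute: "Ric br G x y = Ric br G y x" if "inner_product G"
proof -
  have "(\<Sum>e\<in>onb G. G (br x e) (br y e)) = (\<Sum>e\<in>onb G. G (br y e) (br x e))"
    by (intro sum.cong refl inner_product_commute that)
  then show ?thesis by (simp add: Ric_def mult.commute)
qed

lemma Ric_linear:
  assumes G: "inner_product G" and br: "bilinear br"
  shows "linear (Ric br G x)"
proof -
  note [simp] = bilinear_ladd[OF br] bilinear_lmul[OF br]
    linear_add[OF inner_product_linear(1)[OF G]] linear_cmul[OF inner_product_linear(1)[OF G]]
  show ?thesis
    by (rule linearI)
      (simp_all add: Ric_def sum.distrib sum_distrib_left algebra_simps)
qed

text \<open>The endomorphism is obtained by expanding the Ricci form in an orthonormal basis; uniqueness is the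
  nondegeneracy of the metric.\<close>

lemma Rc:
  assumes G: "inner_product G" and br: "bilinear br"
  shows Rc_linear: "linear (Rc br G)"
    and Rc_Ric: "G (Rc br G x) y = Ric br G x y"
proof -
  define A where "A x = (\<Sum>e\<in>onb G. Ric br G x e *\<^sub>R e)" for x
  note lin = inner_product_linear[OF G]
  have linl: "linear (\<lambda>x. Ric br G x e)" for e
  proof -
    have "Ric br G e = (\<lambda>x. Ric br G x e)" by (rule ext) (rule Ric_commute[OF G])
    then show ?thesis using Ric_linear[OF G br, of e] by simp
  qed
  have "linear A"
    unfolding A_def
    by (intro linear_compose_sum ballI linearI)
      (simp_all add: linear_add[OF linl] linear_cmul[OF linl] scaleR_add_left)
  moreover have A: "G (A x) y = Ric br G x y" for x y
  proof -
    have "G (A x) y = G y (A x)" by (rule inner_product_commute[OF G])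
    also have "\<dots> = (\<Sum>e\<in>onb G. G y e * Ric br G x e)"
      by (simp add: A_def linear_sum[OF lin(1)] linear_cmul[OF lin(1)] mult.commute)
    also have "\<dots> = Ric br G x y"
      by (rule linear_frame_expansion_real[OF G orthonormal_basis_onb[OF G] Ric_linear[OF G br]])
    finally show ?thesis .
  qed
  ultimately have "linear A \<and> (\<forall>x y. G (A x) y = Ric br G x y)" by simp
  moreover have "A' = A" if "linear A' \<and> (\<forall>x y. G (A' x) y = Ric br G x y)" for A'
    using that A by (intro ext inner_product_eqI[OF G]) simp
  ultimately have "linear (Rc br G) \<and> (\<forall>x y. G (Rc br G x) y = Ric br G x y)"
    unfolding Rc_def by (rule theI)
  then show "linear (Rc br G)" "G (Rc br G x) y = Ric br G x y" by auto
qed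

lemma Rc_self_adjoint:
  assumes "inner_product G" "bilinear br"
  shows "G (Rc br G x) y = G x (Rc br G y)"
  using Rc_Ric[OF assms] Ric_commute[OF assms(1)] inner_product_commute[OF assms(1)] by metis

lemma Ric_norm2_eq_trace:
  assumes G: "inner_product G" and br: "bilinear br"
  shows "Ric_norm2 br G = (\<Sum>e\<in>onb G. G (Rc br G (Rc br G e)) e)"
  unfolding Ric_norm2_def
proof (rule sum.cong[OF refl])
  fix e
  have "(\<Sum>f\<in>onb G. (Ric br G e f)\<^sup>2) = (\<Sum>f\<in>onb G. G (Rc br G e) f * G (Rc br G e) f)"
    by (simp add: Rc_Ric[OF G br] power2_eq_square)
  also have "\<dots> = G (Rc br G e) (Rc br G e)"
    by (intro linear_frame_expansion_real[OF G orthonormal_basis_onb[OF G]]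
        inner_product_linear[OF G])
  also have "\<dots> = G (Rc br G (Rc br G e)) e"
    by (simp add: Rc_self_adjoint[OF G br, of "Rc br G e"])
  finally show "(\<Sum>f\<in>onb G. (Ric br G e f)\<^sup>2) = G (Rc br G (Rc br G e)) e" .
qed

definition form_inner ::
  "('a::euclidean_space \<Rightarrow> 'a \<Rightarrow> real) \<Rightarrow> ('a \<Rightarrow> 'a \<Rightarrow> 'a) \<Rightarrow> ('a \<Rightarrow> 'a \<Rightarrow> 'a) \<Rightarrow> real" where
  "form_inner G B C = (\<Sum>e\<in>onb G. \<Sum>f\<in>onb G. G (B e f) (C e f))"

lemma form_inner_commute: "inner_product G \<Longrightarrow> form_inner G B C = form_inner G C B"
  unfolding form_inner_def by (intro sum.cong refl) (rule inner_product_commute)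

lemma delta_norm2_eq: "delta_norm2 br G A = form_inner G (delta br A) (delta br A)"
  by (simp add: delta_norm2_def form_inner_def)

lemma scal_eq: "scal br G = - (1/4) * form_inner G br br"
  by (simp add: scal_def form_inner_def)

lemma bilinear_delta:
  assumes br: "bilinear br" and A: "linear A"
  shows "bilinear (delta br A)"
  unfolding bilinear_def delta_def
  by (auto intro!: linearI simp: linear_add[OF A] linear_cmul[OF A] bilinear_ladd[OF br]
      bilinear_radd[OF br] bilinear_lmul[OF br] bilinear_rmul[OF br] scaleR_diff_right)

text \<open>The adjoint of \<open>\<delta>\<close> applied to the bracket is four times the Ricci endomorphism. The term
  \<open>A[e, f]\<close> of \<open>\<delta>(A)\<close> produces the positive part of the Ricci form, and the terms \<open>[A e, f]\<close> and
  \<open>[e, A f]\<close>, whose contributions agree by antisymmetry, produce the negative part.\<close>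

lemma form_inner_delta_bracket:
  assumes G: "inner_product G" and br: "bilinear br" and anti: "\<And>x y. br y x = - br x y"
    and A: "linear A"
  shows "form_inner G (delta br A) br = 4 * (\<Sum>k\<in>onb G. G (Rc br G (A k)) k)"
proof -
  let ?E = "onb G"
  note lin = inner_product_linear[OF G] and onb = orthonormal_basis_onb[OF G]
  define a where "a = (\<Sum>e\<in>?E. \<Sum>f\<in>?E. G (A (br e f)) (br e f))"
  define b where "b = (\<Sum>e\<in>?E. \<Sum>f\<in>?E. G (br (A e) f) (br e f))"
  have "G (br e (A f)) (br e f) = G (br (A f) e) (br f e)" for e f
    by (simp add: anti[of e "A f"] anti[of e f] linear_neg[OF lin(1)] linear_neg[OF lin(2)])
  then have "(\<Sum>e\<in>?E. \<Sum>f\<in>?E. G (br e (A f)) (br e f)) = (\<Sum>e\<in>?E. \<Sum>f\<in>?E. G (br (A f) e) (br f e))"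
    by simp
  also have "\<dots> = b" unfolding b_def by (rule sum.swap)
  finally have b': "(\<Sum>e\<in>?E. \<Sum>f\<in>?E. G (br e (A f)) (br e f)) = b" .
  have "form_inner G (delta br A) br = a - b - (\<Sum>e\<in>?E. \<Sum>f\<in>?E. G (br e (A f)) (br e f))"
    by (simp add: form_inner_def delta_def linear_diff[OF lin(2)] sum_subtractf a_def b_def)
  then have lhs: "form_inner G (delta br A) br = a - 2 * b" using b' by simp
  have "(\<Sum>k\<in>?E. \<Sum>e\<in>?E. \<Sum>f\<in>?E. G (br e f) (A k) * G (br e f) k)
      = (\<Sum>e\<in>?E. \<Sum>f\<in>?E. \<Sum>k\<in>?E. G (br e f) (A k) * G (br e f) k)"
    by (subst sum.swap) (intro sum.cong refl sum.swap)
  also have "\<dots> = a"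
    unfolding a_def
  proof (intro sum.cong refl)
    fix e f
    have "linear (\<lambda>k. G (br e f) (A k))"
      using linear_compose[OF A lin(1)] by (simp add: o_def)
    from linear_frame_expansion_real[OF G onb this, of "br e f"]
    show "(\<Sum>k\<in>?E. G (br e f) (A k) * G (br e f) k) = G (A (br e f)) (br e f)"
      by (simp add: mult.commute inner_product_commute[OF G, of "A _"])
  qed
  finally have a: "(\<Sum>k\<in>?E. \<Sum>e\<in>?E. \<Sum>f\<in>?E. G (br e f) (A k) * G (br e f) k) = a" .
  have "(\<Sum>k\<in>?E. G (Rc br G (A k)) k) = - (1/2) * b + (1/4) * a"
    by (simp only: Rc_Ric[OF G br] Ric_def sum.distrib sum_distrib_left[symmetric] a b_def)
  then show ?thesis using lhs by simp
qed

section \<open>Variation of the metric\<close>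

text \<open>In a fixed basis \<open>E\<close>, orthonormal at time \<open>t\<close>, the inner product of two forms contains the metric
  once on the values and its inverse once on each of the two arguments. The metric contributes
  \<open>G(A B(e, f), C(e, f))\<close> and each inverse contributes the negative term of \<open>\<delta>(A)\<close> in its argument.\<close>

lemma form_inner_has_derivative:
  fixes G :: "real \<Rightarrow> 'a::euclidean_space \<Rightarrow> 'a \<Rightarrow> real"
  assumes G: "\<And>s. s \<in> I \<Longrightarrow> inner_product (G s)" and t: "t \<in> I"
    and G': "\<And>x y. ((\<lambda>s. G s x y) has_real_derivative G t (A x) y) (at t within I)"
    and A: "\<And>x y. G t (A x) y = G t x (A y)"
    and B: "bilinear B" and C: "bilinear C"
  shows "((\<lambda>s. form_inner (G s) B C) has_real_derivative form_inner (G t) B (delta C A))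
           (at t within I)"
proof -
  note Gt = G[OF t] and onb = orthonormal_basis_onb[OF G[OF t]]
  note lin = inner_product_linear[OF Gt]
  define E where "E = onb (G t)"
  define Q where "Q s = inverse_gram (G t) (G s)" for s
  have fin: "finite E" and on: "\<And>e f. e \<in> E \<Longrightarrow> f \<in> E \<Longrightarrow> G t e f = (if e = f then 1 else 0)"
    using onb by (auto simp: orthonormal_basis_def E_def)
  have MQ: "(\<Sum>d\<in>E. G s e d * Q s d f) = (if e = f then 1 else 0)"
    if "s \<in> I" "e \<in> E" "f \<in> E" for s e f
    unfolding Q_def using gram_inverse_gram[OF G[OF that(1)] Gt onb, of e f] on that by (simp add: E_def)
  have Q': "((\<lambda>s. Q s e f) has_real_derivative - G t (A e) f) (at t within I)"
    if "e \<in> E" "f \<in> E" for e f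
    by (rule has_real_derivative_inverse_matrix[OF fin t G' on MQ that])
  have Qt: "Q t e f = (if e = f then 1 else 0)" if "e \<in> E" "f \<in> E" for e f
  proof -
    have "Q t e f = (\<Sum>d\<in>E. if e = d then Q t d f else 0)" using fin that by simp
    also have "\<dots> = (\<Sum>d\<in>E. G t e d * Q t d f)" using on that by (intro sum.cong) auto
    finally show ?thesis using MQ[OF t that] by simp
  qed
  have pick: "(\<Sum>f\<in>E. Q t e f * r f) = r e" if "e \<in> E" for e and r :: "'a \<Rightarrow> real"
  proof -
    have "(\<Sum>f\<in>E. Q t e f * r f) = (\<Sum>f\<in>E. if e = f then r f else 0)"
      using that by (intro sum.cong) (auto simp: Qt)
    then show ?thesis using fin that by simp
  qed
  have pick': "(\<Sum>f\<in>E. r f * Q t e f) = r e" if "e \<in> E" for e and r :: "'a \<Rightarrow> real"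
    using pick[OF that, of r] by (simp add: mult.commute)
  have BC: "bilinear (\<lambda>x y. G s (B x f) (C y f'))" "bilinear (\<lambda>x y. G s (B e x) (C e' y))"
    if "s \<in> I" for s e e' f f'
    using B C unfolding bilinear_def[of B] bilinear_def[of C]
    by (auto intro!: bilinear_compose[OF inner_product_bilinear[OF G[OF that]]])
  \<comment> \<open>\<open>N\<close> is the inner product expanded in the basis \<open>E\<close>.\<close>
  define N where "N s = (\<Sum>e\<in>E. \<Sum>e'\<in>E. Q s e e' *
      (\<Sum>f\<in>E. \<Sum>f'\<in>E. Q s f f' * G s (B e f) (C e' f')))" for s
  have N: "form_inner (G s) B C = N s" if s: "s \<in> I" for s
  proof -
    have "form_inner (G s) B C
        = (\<Sum>k\<in>onb (G s). \<Sum>f\<in>E. \<Sum>f'\<in>E. Q s f f' * G s (B k f) (C k f'))"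
      unfolding form_inner_def Q_def E_def
      by (intro sum.cong refl frame_sum_inverse_gram[OF _ Gt onb] BC s)
    \<comment> \<open>The factor 1 gives the outer sum the form required by \<open>bilinear_real_combination\<close>.\<close>
    also have "\<dots> = (\<Sum>k\<in>onb (G s). \<Sum>f\<in>E. 1 * (\<Sum>f'\<in>E. Q s f f' * G s (B k f) (C k f')))"
      by simp
    also have "\<dots> = (\<Sum>e\<in>E. \<Sum>e'\<in>E. Q s e e' *
      (\<Sum>f\<in>E. 1 * (\<Sum>f'\<in>E. Q s f f' * G s (B e f) (C e' f'))))"
      unfolding Q_def E_def
      by (intro frame_sum_inverse_gram[OF _ Gt onb] bilinear_real_combination BC s)
    finally show ?thesis by (simp add: N_def)
  qed
  have "(N has_real_derivative (\<Sum>e\<in>E. \<Sum>e'\<in>E.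
      - G t (A e) e' * (\<Sum>f\<in>E. \<Sum>f'\<in>E. Q t f f' * G t (B e f) (C e' f')) +
      (\<Sum>f\<in>E. \<Sum>f'\<in>E. - G t (A f) f' * G t (B e f) (C e' f') +
          G t (A (B e f)) (C e' f') * Q t f f') * Q t e e')) (at t within I)"
    unfolding N_def by (intro DERIV_sum DERIV_mult Q' G')
  also have "(\<Sum>e\<in>E. \<Sum>e'\<in>E.
      - G t (A e) e' * (\<Sum>f\<in>E. \<Sum>f'\<in>E. Q t f f' * G t (B e f) (C e' f')) +
      (\<Sum>f\<in>E. \<Sum>f'\<in>E. - G t (A f) f' * G t (B e f) (C e' f') +
          G t (A (B e f)) (C e' f') * Q t f f') * Q t e e')
    = (\<Sum>e\<in>E. - (\<Sum>e'\<in>E. G t (A e) e' * (\<Sum>f\<in>E. G t (B e f) (C e' f))) +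
        (\<Sum>f\<in>E. - (\<Sum>f'\<in>E. G t (A f) f' * G t (B e f) (C e f')) + G t (A (B e f)) (C e f)))"
  proof (intro sum.cong refl)
    fix e assume e: "e \<in> E"
    have comb: "(\<Sum>e'\<in>E. - a e' * S e' + r e' * Q t e e') = - (\<Sum>e'\<in>E. a e' * S e') + r e"
      for a S r :: "'a \<Rightarrow> real"
      using pick'[OF e, of r] by (simp add: sum.distrib sum_negf sum_subtractf)
    have P: "(\<Sum>f\<in>E. \<Sum>f'\<in>E. Q t f f' * G t (B e f) (C e' f')) = (\<Sum>f\<in>E. G t (B e f) (C e' f))"
      for e' by (intro sum.cong refl pick)
    have R: "(\<Sum>f\<in>E. \<Sum>f'\<in>E. - G t (A f) f' * G t (B e f) (C e' f') +
          G t (A (B e f)) (C e' f') * Q t f f')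
        = (\<Sum>f\<in>E. - (\<Sum>f'\<in>E. G t (A f) f' * G t (B e f) (C e' f')) + G t (A (B e f)) (C e' f))"
      for e' by (intro sum.cong refl) (simp add: sum.distrib sum_negf sum_subtractf pick')
    show "(\<Sum>e'\<in>E.
      - G t (A e) e' * (\<Sum>f\<in>E. \<Sum>f'\<in>E. Q t f f' * G t (B e f) (C e' f')) +
      (\<Sum>f\<in>E. \<Sum>f'\<in>E. - G t (A f) f' * G t (B e f) (C e' f') +
          G t (A (B e f)) (C e' f') * Q t f f') * Q t e e')
      = - (\<Sum>e'\<in>E. G t (A e) e' * (\<Sum>f\<in>E. G t (B e f) (C e' f))) +
        (\<Sum>f\<in>E. - (\<Sum>f'\<in>E. G t (A f) f' * G t (B e f) (C e f')) + G t (A (B e f)) (C e f))"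
      unfolding P R by (rule comb)
  qed
  also have "\<dots> = (\<Sum>e\<in>E. - (\<Sum>f\<in>E. G t (B e f) (C (A e) f)) +
        (\<Sum>f\<in>E. - G t (B e f) (C e (A f)) + G t (A (B e f)) (C e f)))"
  proof -
    have "(\<Sum>e'\<in>E. G t (A e) e' * (\<Sum>f\<in>E. G t (B e f) (C e' f)))
        = (\<Sum>f\<in>E. G t (B e f) (C (A e) f))" for e
    proof -
      have "linear (\<lambda>x. \<Sum>f\<in>E. G t (B e f) (C x f))"
        using C by (intro linear_compose_sum ballI linear_compose[OF _ lin(1), unfolded o_def])
          (simp add: bilinear_def)
      from linear_frame_expansion_real[OF Gt onb this] show ?thesis by (simp add: E_def)
    qed
    moreover have "(\<Sum>f'\<in>E. G t (A f) f' * G t (B e f) (C e f')) = G t (B e f) (C e (A f))" for e f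
    proof -
      have "linear (\<lambda>x. G t (B e f) (C e x))"
        using C by (intro linear_compose[OF _ lin(1), unfolded o_def]) (simp add: bilinear_def)
      from linear_frame_expansion_real[OF Gt onb this] show ?thesis by (simp add: E_def)
    qed
    ultimately show ?thesis by simp
  qed
  also have "\<dots> = form_inner (G t) B (delta C A)"
    by (simp add: form_inner_def E_def[symmetric] delta_def linear_diff[OF lin(1)] A
        sum.distrib sum_negf sum_subtractf)
  finally show ?thesis
    by (rule has_field_derivative_transform_within[OF _ zero_less_one t]) (simp add: N)
qed

lemma form_inner_ricci_flow:
  fixes G :: "real \<Rightarrow> 'a::euclidean_space \<Rightarrow> 'a \<Rightarrow> real"
  assumes G: "\<And>s. s \<in> I \<Longrightarrow> inner_product (G s)" and t: "t \<in> I"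
    and flow: "\<And>x y. ((\<lambda>s. G s x y) has_real_derivative - 2 * Ric br (G t) x y) (at t within I)"
    and br: "bilinear br" and B: "bilinear B"
  shows "((\<lambda>s. form_inner (G s) B br) has_real_derivative
           - 2 * form_inner (G t) B (delta br (Rc br (G t)))) (at t within I)"
proof -
  note Gt = G[OF t]
  note lin = inner_product_linear[OF Gt]
  define A where "A x = (- 2) *\<^sub>R Rc br (G t) x" for x
  have A: "G t (A x) y = G t x (A y)" "G t (A x) y = - 2 * Ric br (G t) x y" for x y
    using Rc_self_adjoint[OF Gt br, of x y] Rc_Ric[OF Gt br, of x y]
    unfolding A_def linear_cmul[OF lin(1)] linear_cmul[OF lin(2)] by auto
  have "((\<lambda>s. form_inner (G s) B br) has_real_derivative form_inner (G t) B (delta br A))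
          (at t within I)"
    using flow by (intro form_inner_has_derivative G t B br A(1)) (simp_all only: A(2))
  moreover have "delta br A x y = (- 2) *\<^sub>R delta br (Rc br (G t)) x y" for x y
    unfolding delta_def A_def bilinear_lmul[OF br] bilinear_rmul[OF br] scaleR_diff_right ..
  then have "form_inner (G t) B (delta br A) = - 2 * form_inner (G t) B (delta br (Rc br (G t)))"
    unfolding form_inner_def by (simp add: linear_cmul[OF lin(1)] sum_distrib_left linear_neg[OF lin(1)])
  ultimately show ?thesis by simp
qed

lemma scal_ricci_flow:
  fixes G :: "real \<Rightarrow> 'a::euclidean_space \<Rightarrow> 'a \<Rightarrow> real"
  assumes G: "\<And>s. s \<in> I \<Longrightarrow> inner_product (G s)" and t: "t \<in> I"
    and flow: "\<And>x y. ((\<lambda>s. G s x y) has_real_derivative - 2 * Ric br (G t) x y) (at t within I)"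
    and br: "bilinear br" and anti: "\<And>x y. br y x = - br x y"
  shows "((\<lambda>s. scal br (G s)) has_real_derivative 2 * Ric_norm2 br (G t)) (at t within I)"
proof -
  note Gt = G[OF t]
  have "form_inner (G t) br (delta br (Rc br (G t))) = 4 * Ric_norm2 br (G t)"
    using form_inner_delta_bracket[OF Gt br anti Rc_linear[OF Gt br]]
    by (simp add: form_inner_commute[OF Gt, of br] Ric_norm2_eq_trace[OF Gt br])
  then show ?thesis
    using DERIV_cmult[OF form_inner_ricci_flow[OF G t flow br br], of "- (1/4)"]
    by (simp add: scal_eq)
qed

text \<open>By \<open>form_inner_delta_bracket\<close> the trace is a quarter of \<open>\<langle>\<delta>(A), br\<rangle>\<close>, whose first argument does
  not depend on time.\<close>

lemma trace_Rc_ricci_flow: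
  fixes G :: "real \<Rightarrow> 'a::euclidean_space \<Rightarrow> 'a \<Rightarrow> real"
  assumes G: "\<And>s. s \<in> I \<Longrightarrow> inner_product (G s)" and t: "t \<in> I"
    and flow: "\<And>x y. ((\<lambda>s. G s x y) has_real_derivative - 2 * Ric br (G t) x y) (at t within I)"
    and br: "bilinear br" and anti: "\<And>x y. br y x = - br x y" and A: "linear A"
  shows "((\<lambda>s. \<Sum>b\<in>Basis. Rc br (G s) (A b) \<bullet> b) has_real_derivative
           - (1/2) * form_inner (G t) (delta br A) (delta br (Rc br (G t)))) (at t within I)"
proof -
  have eq: "1/4 * form_inner (G s) (delta br A) br = (\<Sum>b\<in>Basis. Rc br (G s) (A b) \<bullet> b)"
    if s: "s \<in> I" for s
    using trace_frame_independent[OF G[OF s] orthonormal_basis_onb[OF G[OF s]]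
        inner_product_inner orthonormal_basis_Basis
        linear_compose[OF A Rc_linear[OF G[OF s] br]]]
      form_inner_delta_bracket[OF G[OF s] br anti A]
    by (simp add: o_def)
  have "((\<lambda>s. 1/4 * form_inner (G s) (delta br A) br) has_real_derivative
      - (1/2) * form_inner (G t) (delta br A) (delta br (Rc br (G t)))) (at t within I)"
    using DERIV_cmult[OF form_inner_ricci_flow[OF G t flow br bilinear_delta[OF br A]], of "1/4"]
    by simp
  then show ?thesis
    by (rule has_field_derivative_transform_within[OF _ zero_less_one t]) (rule eq)
qed

text \<open>The norm is the trace of the square of \<open>Rc\<close>. Writing \<open>X\<close> for \<open>Rc\<close> at time \<open>s\<close> and \<open>Y\<close> for \<open>Rc\<close> at
  time \<open>t\<close>, the decomposition \<open>tr (X X) = tr ((X - Y) (X - Y)) + 2 tr (X Y) - tr (Y Y)\<close> leaves only the middle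
  term to be differentiated at \<open>s = t\<close>, because the first vanishes to second order.\<close>

lemma Ric_norm2_ricci_flow:
  fixes G :: "real \<Rightarrow> 'a::euclidean_space \<Rightarrow> 'a \<Rightarrow> real"
  assumes G: "\<And>s. s \<in> I \<Longrightarrow> inner_product (G s)" and t: "t \<in> I"
    and flow: "\<And>x y. ((\<lambda>s. G s x y) has_real_derivative - 2 * Ric br (G t) x y) (at t within I)"
    and br: "bilinear br" and anti: "\<And>x y. br y x = - br x y"
  shows "((\<lambda>s. Ric_norm2 br (G s)) has_real_derivative - delta_norm2 br (G t) (Rc br (G t)))
           (at t within I)"
proof -
  define r where "r s i j = Rc br (G s) i \<bullet> j" for s i j
  have tr': "((\<lambda>s. \<Sum>b\<in>Basis. Rc br (G s) (A b) \<bullet> b) has_real_derivative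
      - (1/2) * form_inner (G t) (delta br A) (delta br (Rc br (G t)))) (at t within I)"
    if "linear A" for A
    by (intro trace_Rc_ricci_flow G t flow br anti that)
  \<comment> \<open>A matrix entry of \<open>Rc\<close> is the trace of its product with a matrix of rank one.\<close>
  have r': "\<exists>D. ((\<lambda>s. r s i j) has_real_derivative D) (at t within I)" for i j
  proof -
    have lin: "linear (\<lambda>x. (x \<bullet> j) *\<^sub>R i)"
      by (auto intro!: linearI simp: inner_add_left scaleR_add_left)
    have "r s i j = (\<Sum>b\<in>Basis. Rc br (G s) ((b \<bullet> j) *\<^sub>R i) \<bullet> b)" if s: "s \<in> I" for s
      unfolding r_def linear_cmul[OF Rc_linear[OF G[OF s] br]]
      by (subst euclidean_inner) (simp add: inner_commute mult.commute)
    from has_field_derivative_transform_within[OF tr'[OF lin] zero_less_one t this[symmetric]]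
    show ?thesis by blast
  qed
  have prod: "(\<Sum>b\<in>Basis. Rc br (G s) (Rc br (G u) b) \<bullet> b)
      = (\<Sum>b\<in>Basis. \<Sum>j\<in>Basis. r u b j * r s j b)" if s: "s \<in> I" for s u
  proof (rule sum.cong[OF refl])
    fix b :: 'a
    have "linear (\<lambda>x. Rc br (G s) x \<bullet> b)"
      using linear_compose[OF Rc_linear[OF G[OF s] br]
          inner_product_linear(2)[OF inner_product_inner]] by (simp add: o_def)
    from linear_frame_expansion_real[OF inner_product_inner orthonormal_basis_Basis this]
    show "Rc br (G s) (Rc br (G u) b) \<bullet> b = (\<Sum>j\<in>Basis. r u b j * r s j b)"
      by (simp add: r_def)
  qed
  have norm: "Ric_norm2 br (G s) = (\<Sum>b\<in>Basis. Rc br (G s) (Rc br (G s) b) \<bullet> b)"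
    if s: "s \<in> I" for s
    using trace_frame_independent[OF G[OF s] orthonormal_basis_onb[OF G[OF s]]
        inner_product_inner orthonormal_basis_Basis
        linear_compose[OF Rc_linear[OF G[OF s] br] Rc_linear[OF G[OF s] br]]]
    by (simp add: Ric_norm2_eq_trace[OF G[OF s] br])
  define q where "q s = (\<Sum>b\<in>Basis. \<Sum>j\<in>Basis. (r s b j - r t b j) * (r s j b - r t j b))" for s
  have split: "q s + 2 * (\<Sum>b\<in>Basis. Rc br (G s) (Rc br (G t) b) \<bullet> b) - Ric_norm2 br (G t)
      = Ric_norm2 br (G s)" if s: "s \<in> I" for s
  proof -
    have "(\<Sum>b\<in>Basis. \<Sum>j\<in>Basis. r s b j * r t j b) = (\<Sum>b\<in>Basis. \<Sum>j\<in>Basis. r t b j * r s j b)"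
      by (subst sum.swap) (simp add: mult.commute)
    then show ?thesis
      by (simp add: norm[OF s] norm[OF t] prod[OF s] prod[OF t] q_def left_diff_distrib
          right_diff_distrib sum_subtractf)
  qed
  have "(q has_real_derivative 0) (at t within I)"
  proof -
    obtain d where d: "\<And>i j. ((\<lambda>s. r s i j) has_real_derivative d i j) (at t within I)"
      using r' by metis
    have "(q has_real_derivative (\<Sum>b\<in>Basis. \<Sum>j\<in>Basis.
        (d b j - 0) * (r t j b - r t j b) + (d j b - 0) * (r t b j - r t b j))) (at t within I)"
      unfolding q_def by (intro DERIV_sum DERIV_mult DERIV_diff DERIV_const d)
    then show ?thesis by simp
  qed
  from DERIV_diff[OF DERIV_add[OF this DERIV_cmult[OF tr'[OF Rc_linear[OF G[OF t] br]], of 2]]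
      DERIV_const[of "Ric_norm2 br (G t)"]]
  have "((\<lambda>s. q s + 2 * (\<Sum>b\<in>Basis. Rc br (G s) (Rc br (G t) b) \<bullet> b) - Ric_norm2 br (G t))
      has_real_derivative - delta_norm2 br (G t) (Rc br (G t))) (at t within I)"
    by (simp add: delta_norm2_eq)
  then show ?thesis
    by (rule has_field_derivative_transform_within[OF _ zero_less_one t]) (simp add: split)
qed

text \<open>Since \<open>\<delta>(1) = - br\<close>, this is the expansion of a square; the mixed term is evaluated by
  \<open>form_inner_delta_bracket\<close>.\<close>

lemma delta_norm2_shift:
  assumes G: "inner_product G" and br: "bilinear br" and anti: "\<And>x y. br y x = - br x y"
  shows "delta_norm2 br G (\<lambda>x. Rc br G x + c *\<^sub>R x)
    = delta_norm2 br G (Rc br G) - 8 * c * Ric_norm2 br G - 4 * c\<^sup>2 * scal br G"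
proof -
  note lin = inner_product_linear[OF G]
  let ?D = "delta br (Rc br G)"
  have "delta br (\<lambda>x. Rc br G x + c *\<^sub>R x) x y = ?D x y - c *\<^sub>R br x y" for x y
    by (simp add: delta_def bilinear_ladd[OF br] bilinear_radd[OF br] bilinear_lmul[OF br]
        bilinear_rmul[OF br])
  then have "delta br (\<lambda>x. Rc br G x + c *\<^sub>R x) = (\<lambda>x y. ?D x y - c *\<^sub>R br x y)"
    by (intro ext)
  then have "delta_norm2 br G (\<lambda>x. Rc br G x + c *\<^sub>R x)
      = (\<Sum>e\<in>onb G. \<Sum>f\<in>onb G. G (?D e f - c *\<^sub>R br e f) (?D e f - c *\<^sub>R br e f))"
    by (simp add: delta_norm2_def)
  also have "\<dots> = (\<Sum>e\<in>onb G. \<Sum>f\<in>onb G. G (?D e f) (?D e f) - 2 * c * G (?D e f) (br e f)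
          + c\<^sup>2 * G (br e f) (br e f))"
  proof (intro sum.cong refl)
    fix e f
    have "G (?D e f - c *\<^sub>R br e f) (?D e f - c *\<^sub>R br e f)
        = G (?D e f) (?D e f) - c * G (?D e f) (br e f) - c * G (br e f) (?D e f)
          + c\<^sup>2 * G (br e f) (br e f)"
      by (simp add: linear_diff[OF lin(1)] linear_diff[OF lin(2)] linear_cmul[OF lin(1)]
          linear_cmul[OF lin(2)] power2_eq_square algebra_simps)
    then show "G (?D e f - c *\<^sub>R br e f) (?D e f - c *\<^sub>R br e f)
        = G (?D e f) (?D e f) - 2 * c * G (?D e f) (br e f) + c\<^sup>2 * G (br e f) (br e f)"
      using inner_product_commute[OF G, of "br e f" "?D e f"] by simp
  qed
  also have "\<dots> = delta_norm2 br G (Rc br G) - 2 * c * form_inner G ?D br + c\<^sup>2 * form_inner G br br"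
    by (simp add: delta_norm2_def form_inner_def sum.distrib sum_subtractf sum_distrib_left)
  finally show ?thesis
    by (simp add: form_inner_delta_bracket[OF G br anti Rc_linear[OF G br]]
        Ric_norm2_eq_trace[OF G br] scal_eq)
qed

section \<open>The bracket of a Lie group\<close>

lemma lie_bracket_antisym: "lie_bracket \<G> c w v = - lie_bracket \<G> c v w"
  by (simp add: lie_bracket_def)

text \<open>The set on which the product is defined in the coordinates of \<open>c\<close> is the preimage of the chart domain
  under the continuous multiplication. Openness is what turns differentiability on the set
  into differentiability at its points.\<close>

lemma (in lie_group) chart_mult_domain_open:
  fixes c :: "('g, 'a) chart"
  assumes c: "c \<in> \<A>"
  shows "open {(chart_map c p, chart_map c q) | p q.
            p \<in> chart_dom c \<and> q \<in> chart_dom c \<and> p \<otimes> q \<in> chart_dom c}" (is "open ?S")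
proof -
  let ?D = "chart_dom c" and ?\<phi> = "chart_map c" and ?\<psi> = "chart_inv c"
  let ?U = "?\<phi> ` ?D"
  have openD: "openin T ?D" and openU: "open ?U" using chart_open[OF c] by auto
  have top: "topspace (subtopology T ?D) = ?D"
    using openin_subset[OF openD] by (rule topspace_subtopology_subset)
  obtain k where k: "homeomorphic_maps (subtopology T ?D) (top_of_set ?U) ?\<phi> k"
    using chart_homeomorphic[OF c] homeomorphic_map_maps by blast
  have k\<phi>: "\<And>p. p \<in> ?D \<Longrightarrow> k (?\<phi> p) = p" using k top by (simp add: homeomorphic_maps_def)
  then have inj: "inj_on ?\<phi> ?D" by (rule inj_on_inverseI)
  have \<psi>\<phi>: "\<And>p. p \<in> ?D \<Longrightarrow> ?\<psi> (?\<phi> p) = p" using inj by simp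
  have "continuous_map (top_of_set ?U) (subtopology T ?D) ?\<psi>"
  proof (rule continuous_map_eq)
    show "continuous_map (top_of_set ?U) (subtopology T ?D) k"
      using k by (simp add: homeomorphic_maps_def)
    show "k x = ?\<psi> x" if "x \<in> topspace (top_of_set ?U)" for x
      using that k\<phi> \<psi>\<phi> by auto
  qed
  then have \<psi>: "continuous_map (top_of_set ?U) T ?\<psi>"
    by (simp add: continuous_map_in_subtopology)
  have "continuous_map (top_of_set (?U \<times> ?U)) (prod_topology T T) (\<lambda>(x, y). (?\<psi> x, ?\<psi> y))"
    using \<psi> unfolding prod_topology_subtopology_eu[symmetric] continuous_map_prod_top by blast
  from continuous_map_compose[OF this mult_continuous]
  have "continuous_map (top_of_set (?U \<times> ?U)) T (\<lambda>(x, y). ?\<psi> x \<otimes> ?\<psi> y)"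
    by (simp add: o_def case_prod_unfold)
  from openin_continuous_map_preimage[OF this openD]
  have "openin (top_of_set (?U \<times> ?U)) {z \<in> ?U \<times> ?U. (\<lambda>(x, y). ?\<psi> x \<otimes> ?\<psi> y) z \<in> ?D}"
    by simp
  also have "{z \<in> ?U \<times> ?U. (\<lambda>(x, y). ?\<psi> x \<otimes> ?\<psi> y) z \<in> ?D} = ?S"
    by (auto simp: \<psi>\<phi>) blast
  finally show ?thesis
    using openin_open_eq open_Times[OF openU openU] by blast
qed

text \<open>For \<open>x\<close> near the identity, a left-invariant field at \<open>x\<close> is the partial derivative of the
  product \<open>\<mu>\<close> in its second argument. It is therefore linear in the tangent vector that it extends,
  and differentiable in \<open>x\<close> because \<open>\<mu>\<close> is twice differentiable.\<close>

lemma (in lie_group) bilinear_lie_bracket: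
  fixes c :: "('g, 'a) chart"
  assumes c: "c \<in> \<A>" and one: "\<one> \<in> chart_dom c"
  shows "bilinear (lie_bracket \<G> c)"
proof -
  let ?D = "chart_dom c" and ?\<phi> = "chart_map c" and ?\<psi> = "chart_inv c"
  define \<mu> where "\<mu> = (\<lambda>(x, y). ?\<phi> (?\<psi> x \<otimes> ?\<psi> y))"
  define S where "S = {(?\<phi> p, ?\<phi> q) | p q. p \<in> ?D \<and> q \<in> ?D \<and> p \<otimes> q \<in> ?D}"
  define e where "e = ?\<phi> \<one>"
  have openS: "open S" unfolding S_def by (rule chart_mult_domain_open[OF c])
  have ee: "(e, e) \<in> S" using one by (simp add: S_def e_def) (metis one_closed l_one)
  have "smooth_on \<mu> S" unfolding \<mu>_def S_def by (rule mult_smooth[OF c c c])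
  then have "Ck_on (Suc (Suc 0)) \<mu> S" by (simp only: smooth_on_def)
  then have d1: "\<mu> differentiable_on S"
    and d2: "\<And>v. (\<lambda>z. frechet_derivative \<mu> (at z) v) differentiable_on S"
    by auto
  define V where "V = {x. (x, e) \<in> S}"
  have "open ((\<lambda>x. (x, e)) -` S)"
    by (intro open_vimage openS continuous_intros)
  then have openV: "open V" by (simp add: V_def vimage_def)
  have eV: "e \<in> V" using ee by (simp add: V_def)
  have \<mu>': "(\<mu> has_derivative frechet_derivative \<mu> (at z)) (at z)" if "z \<in> S" for z
    using d1 that unfolding differentiable_on_eq_differentiable_at[OF openS]
    by (blast intro: frechet_derivative_works[THEN iffD1])
  have field: "left_inv_field \<G> c w x = frechet_derivative \<mu> (at (x, e)) (0, w)"
    if "x \<in> V" for w x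
  proof -
    have pair: "((\<lambda>y. (x, y)) has_derivative (\<lambda>w. (0, w))) (at e)"
      by (intro derivative_eq_intros) auto
    have "((\<lambda>y. \<mu> (x, y)) has_derivative (\<lambda>w. frechet_derivative \<mu> (at (x, e)) (0, w))) (at e)"
      using diff_chain_at[OF pair \<mu>'[of "(x, e)"]] that by (simp add: V_def o_def)
    from frechet_derivative_at[OF this] show ?thesis
      by (simp add: left_inv_field_def \<mu>_def e_def fun_eq_iff)
  qed
  have field': "(left_inv_field \<G> c w has_derivative
      frechet_derivative (left_inv_field \<G> c w) (at e)) (at e)" for w
  proof -
    have "(\<lambda>z. frechet_derivative \<mu> (at z) (0, w)) differentiable (at (e, e))"
      using d2 ee unfolding differentiable_on_eq_differentiable_at[OF openS] by blast
    moreover have pair: "((\<lambda>x. (x, e)) has_derivative (\<lambda>w. (w, 0))) (at e)"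
      by (intro derivative_eq_intros) auto
    ultimately obtain F where "((\<lambda>x. frechet_derivative \<mu> (at (x, e)) (0, w)) has_derivative F) (at e)"
      using diff_chain_at[OF pair] unfolding differentiable_def o_def by blast
    then have "(left_inv_field \<G> c w has_derivative F) (at e)"
      by (rule has_derivative_transform_within_open[OF _ openV eV]) (simp add: field)
    then show ?thesis using frechet_derivative_at by metis
  qed
  have lin: "linear (frechet_derivative \<mu> (at (x, e)))" if "x \<in> V" for x
    using \<mu>' that by (auto simp: V_def intro: has_derivative_linear)
  have linl: "linear (frechet_derivative (left_inv_field \<G> c w) (at e))" for w
    using field' by (rule has_derivative_linear)
  have linr: "linear (\<lambda>w. frechet_derivative (left_inv_field \<G> c w) (at e) v)" for v
  proof (rule linearI)
    fix w w'
    have "(left_inv_field \<G> c (w + w') has_derivative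
        (\<lambda>v. frechet_derivative (left_inv_field \<G> c w) (at e) v +
             frechet_derivative (left_inv_field \<G> c w') (at e) v)) (at e)"
    proof (rule has_derivative_transform_within_open[OF has_derivative_add[OF field' field'] openV eV])
      show "left_inv_field \<G> c w x + left_inv_field \<G> c w' x = left_inv_field \<G> c (w + w') x"
        if "x \<in> V" for x
        using linear_add[OF lin[OF that], of "(0, w)" "(0, w')"] by (simp add: field that)
    qed
    from frechet_derivative_at[OF this]
    show "frechet_derivative (left_inv_field \<G> c (w + w')) (at e) v =
        frechet_derivative (left_inv_field \<G> c w) (at e) v +
        frechet_derivative (left_inv_field \<G> c w') (at e) v" by metis
  next
    fix r w
    have "(left_inv_field \<G> c (r *\<^sub>R w) has_derivative
        (\<lambda>v. r *\<^sub>R frechet_derivative (left_inv_field \<G> c w) (at e) v)) (at e)"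
    proof (rule has_derivative_transform_within_open[OF has_derivative_scaleR_right[OF field'] openV eV])
      show "r *\<^sub>R left_inv_field \<G> c w x = left_inv_field \<G> c (r *\<^sub>R w) x"
        if "x \<in> V" for x
        using linear_cmul[OF lin[OF that], of r "(0, w)"] by (simp add: field that)
    qed
    from frechet_derivative_at[OF this]
    show "frechet_derivative (left_inv_field \<G> c (r *\<^sub>R w)) (at e) v =
        r *\<^sub>R frechet_derivative (left_inv_field \<G> c w) (at e) v" by metis
  qed
  show ?thesis
    unfolding bilinear_def lie_bracket_def e_def[symmetric]
    by (intro conjI allI linear_compose_sub linl linr)
qed

section \<open>The derivative of the expander entropy\<close>

theorem proposition4p10:
  fixes \<G> :: "('g, 'm) monoid_scheme"
    and T :: "'g topology"
    and \<A> :: "('g, 'a::euclidean_space) chart set"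
    and g :: "real \<Rightarrow> ('g, 'a) metric"
    and c :: "('g, 'a) chart"
    and I :: "real set"
    and t :: real
  assumes "lie_group \<G> T \<A>"
    and "nilpotent_group \<G>"
    and "invariant_ricci_flow \<G> \<A> I g"
    and "c \<in> \<A>" and "\<one>\<^bsub>\<G>\<^esub> \<in> chart_dom c"
    and "t \<in> I" and "t \<noteq> 0"
  defines "br \<equiv> lie_bracket \<G> c"
    and "G \<equiv> (\<lambda>s. g s c \<one>\<^bsub>\<G>\<^esub>)"
  shows "((\<lambda>s. W_plus br (G s) s) has_real_derivative
            - t\<^sup>2 * delta_norm2 br (G t) (\<lambda>x. Rc br (G t) x + (1 / (2 * t)) *\<^sub>R x)) (at t within I)"
proof -
  note t = \<open>t \<in> I\<close>
  have br: "bilinear br"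
    unfolding br_def using assms(1,4,5) by (rule lie_group.bilinear_lie_bracket)
  have anti: "br y x = - br x y" for x y
    unfolding br_def by (rule lie_bracket_antisym)
  have G: "inner_product (G s)" if "s \<in> I" for s
    using assms(3,4,5) that
    by (auto simp: G_def invariant_ricci_flow_def invariant_metric_def riemannian_metric_def)
  have flow: "((\<lambda>s. G s x y) has_real_derivative - 2 * Ric br (G t) x y) (at t within I)" for x y
    using assms(3,4,5) t unfolding invariant_ricci_flow_def G_def br_def by blast
  note scal' = scal_ricci_flow[OF G t flow br anti] and norm' = Ric_norm2_ricci_flow[OF G t flow br anti]
  have "((\<lambda>s. s * scal br (G s) + s * s * Ric_norm2 br (G s)) has_real_derivative
      (1 * scal br (G t) + 2 * Ric_norm2 br (G t) * t) +
      ((1 * t + 1 * t) * Ric_norm2 br (G t) + - delta_norm2 br (G t) (Rc br (G t)) * (t * t)))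
      (at t within I)"
    by (intro DERIV_add DERIV_mult DERIV_ident scal' norm')
  moreover have "(1 * scal br (G t) + 2 * Ric_norm2 br (G t) * t) +
      ((1 * t + 1 * t) * Ric_norm2 br (G t) + - delta_norm2 br (G t) (Rc br (G t)) * (t * t))
    = - t\<^sup>2 * delta_norm2 br (G t) (\<lambda>x. Rc br (G t) x + (1 / (2 * t)) *\<^sub>R x)"
    using \<open>t \<noteq> 0\<close> unfolding delta_norm2_shift[OF G[OF t] br anti]
    by (simp add: field_simps power2_eq_square)
  ultimately show ?thesis by (simp add: W_plus_def power2_eq_square)
qed

end
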